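(* Let $L<H$ be reals, $\Theta=\{L,H\}^n$ the two-values domain, $\mathcal{A}\subseteq\mathbb{R}_+^n$ a set of feasible allocations and $A:\Theta\to\mathcal{A}$ an algorithm. The $\left(\frac12\right)$-linear mechanism with algorithm $A$ is bribeproof on $\Theta$ if and only if $A$ satisfies bounded influence, i.e. for all $\theta\in\Theta$ and all $i,j\in N$, $$I_i(A_i,\theta)\ \ge\ |I_i(A_j,\theta)|.$$
   Context: There is a set $N=\{1,\dots,n\}$ of $n\ge 2$ agents and a set $\mathcal{A}\subseteq\mathbb{R}_+^n$ of feasible allocations; $a_i$ is the amount of work allocated to agent $i$, whose cost for $a\in\mathcal{A}$ is $a_i\theta_i$, where $\theta_i\in\Theta_i\subseteq\mathbb{R}$ is her private type. $\Theta=\Theta_1\times\cdots\times\Theta_n$. A mechanism is a pair $(A,p)$ with $A:\Theta\to\mathcal{A}$ (the algorithm) and $p:\Theta\to\mathbb{R}^n$ (payments made to the agents). Notation: $(x,\theta_{-i})$ is $\theta$ with its $i$-th entry replaced by $x$. $(A,p)$ is bribeproof (on $\Theta$) if for all $\theta\in\Theta$, all $i,j\in N$ and all $\hat\theta_i\in\Theta_i$, writing $\hat\theta=(\hat\theta_i,\theta_{-i})$: if $i\ne j$, $p_i(\theta)-A_i(\theta)\theta_i+p_j(\theta)-A_j(\theta)\theta_j\ge p_i(\hat\theta)-A_i(\hat\theta)\theta_i+p_j(\hat\theta)-A_j(\hat\theta)\theta_j$; and, for $i=j$ (strategyproofness), $p_i(\theta)-A_i(\theta)\theta_i\ge p_i(\hat\theta)-A_i(\hat\theta)\theta_i$.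 The $\left(\frac12\right)$-linear mechanism with algorithm $A$ is the mechanism $(A,p)$ with $p_i(\theta)=A_i(\theta)\,\frac{L+H}{2}+f_i$ for all $i$ and $\theta$, where the $f_i$ are arbitrary real constants (bribeproofness does not depend on them). For agents $i,k$ and $\theta\in\Theta$, $I_i(A_k,\theta):=A_k(L,\theta_{-i})-A_k(H,\theta_{-i})$. *)

theory Defs
  imports "HOL-Analysis.Analysis"
begin

text \<open>Agents are the elements of a finite type \<open>'n\<close>, so \<open>n = CARD('n)\<close>; allocations, type profiles
  and payment profiles are vectors in \<open>real ^ 'n\<close>. A mechanism is a pair \<open>(A, p)\<close> of an algorithm
  and a payment rule. Both are total functions, but all notions below that speak about a
  type domain only evaluate them on profiles in that domain.\<close>

type_synonym 'n algorithm = "real ^ 'n \<Rightarrow> real ^ 'n"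
type_synonym 'n mechanism = "(real ^ 'n \<Rightarrow> real ^ 'n) \<times> (real ^ 'n \<Rightarrow> real ^ 'n)"

definition nonneg_orthant :: "(real ^ 'n::finite) set" where
  "nonneg_orthant = {a. \<forall>i. 0 \<le> a $ i}"

definition profiles :: "('n::finite \<Rightarrow> real set) \<Rightarrow> (real ^ 'n) set" where
  "profiles T = {\<theta>. \<forall>i. \<theta> $ i \<in> T i}"

definition two_values :: "real \<Rightarrow> real \<Rightarrow> 'n::finite \<Rightarrow> real set" where
  "two_values L H = (\<lambda>i. {L, H})"

text \<open>\<open>replace i x \<theta>\<close> is \<open>(x, \<theta>\<^sub>-\<^sub>i)\<close>.\<close>

definition replace :: "'n::finite \<Rightarrow> real \<Rightarrow> real ^ 'n \<Rightarrow> real ^ 'n" where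
  "replace i x \<theta> = (\<chi> k. if k = i then x else \<theta> $ k)"

text \<open>\<open>utility M i t \<theta>\<close> is the utility of agent \<open>i\<close> when her true type is \<open>t\<close> and the reported
  profile is \<open>\<theta>\<close>.\<close>

definition utility :: "'n::finite mechanism \<Rightarrow> 'n \<Rightarrow> real \<Rightarrow> real ^ 'n \<Rightarrow> real" where
  "utility M i t \<theta> = snd M \<theta> $ i - fst M \<theta> $ i * t"

definition bribeproof :: "('n::finite \<Rightarrow> real set) \<Rightarrow> 'n mechanism \<Rightarrow> bool" where
  "bribeproof T M \<longleftrightarrow>
    (\<forall>\<theta>\<in>profiles T. \<forall>i j. \<forall>x\<in>T i.
      (i \<noteq> j \<longrightarrow>
        utility M i (\<theta> $ i) \<theta> + utility M j (\<theta> $ j) \<theta>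
          \<ge> utility M i (\<theta> $ i) (replace i x \<theta>) + utility M j (\<theta> $ j) (replace i x \<theta>)) \<and>
      (i = j \<longrightarrow>
        utility M i (\<theta> $ i) \<theta> \<ge> utility M i (\<theta> $ i) (replace i x \<theta>)))"

definition half_linear_mechanism ::
    "real \<Rightarrow> real \<Rightarrow> real ^ 'n \<Rightarrow> 'n::finite algorithm \<Rightarrow> 'n mechanism" where
  "half_linear_mechanism L H f A = (A, \<lambda>\<theta>. \<chi> i. A \<theta> $ i * ((L + H) / 2) + f $ i)"

text \<open>\<open>influence L H A i k \<theta>\<close> is \<open>I\<^sub>i(A\<^sub>k, \<theta>)\<close>.\<close>

definition influence ::
    "real \<Rightarrow> real \<Rightarrow> 'n::finite algorithm \<Rightarrow> 'n \<Rightarrow> 'n \<Rightarrow> real ^ 'n \<Rightarrow> real" where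
  "influence L H A i k \<theta> = A (replace i L \<theta>) $ k - A (replace i H \<theta>) $ k"

definition bounded_influence :: "real \<Rightarrow> real \<Rightarrow> 'n::finite algorithm \<Rightarrow> bool" where
  "bounded_influence L H A \<longleftrightarrow>
    (\<forall>\<theta>\<in>profiles (two_values L H). \<forall>i j. influence L H A i i \<theta> \<ge> \<bar>influence L H A i j \<theta>\<bar>)"

end

theory Submission
  imports Defs
begin

text \<open>With \<open>d = (H - L) / 2\<close>, the utility of an agent is, up to a constant, \<open>d\<close> times her work if
  her type is \<open>L\<close> and \<open>-d\<close> times her work if it is \<open>H\<close>. Fix the types of the others. For the pair
  \<open>i\<close>, \<open>j\<close>, truth-telling of \<open>i\<close> therefore amounts to \<open>I\<^sub>i(A\<^sub>i) + I\<^sub>i(A\<^sub>j) \<ge> 0\<close> when \<open>\<theta>\<^sub>i = \<theta>\<^sub>j\<close> and to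
  \<open>I\<^sub>i(A\<^sub>i) - I\<^sub>i(A\<^sub>j) \<ge> 0\<close> when \<open>\<theta>\<^sub>i \<noteq> \<theta>\<^sub>j\<close>. Since influences do not depend on \<open>\<theta>\<^sub>i\<close>, the two
  values of \<open>\<theta>\<^sub>i\<close> together give \<open>I\<^sub>i(A\<^sub>i) \<ge> \<bar>I\<^sub>i(A\<^sub>j)\<bar>\<close>.\<close>

lemma replace_nth: "replace i x \<theta> $ k = (if k = i then x else \<theta> $ k)"
  by (simp add: replace_def)

lemma replace_replace [simp]: "replace i x (replace i y \<theta>) = replace i x \<theta>"
  by (simp add: vec_eq_iff replace_nth)

lemma replace_self [simp]: "replace i (\<theta> $ i) \<theta> = \<theta>"
  by (simp add: vec_eq_iff replace_nth)

lemma replace_in_profiles: "\<theta> \<in> profiles T \<Longrightarrow> x \<in> T i \<Longrightarrow> replace i x \<theta> \<in> profiles T"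
  by (simp add: profiles_def replace_nth)

lemma two_values_cases:
  assumes "\<theta> \<in> profiles (two_values L H)"
  shows "\<theta> $ i = L \<or> \<theta> $ i = H"
  using assms by (auto simp: profiles_def two_values_def)

lemma utility_half_linear_mechanism:
  "utility (half_linear_mechanism L H f A) i t \<theta> = A \<theta> $ i * ((L + H) / 2 - t) + f $ i"
  by (simp add: utility_def half_linear_mechanism_def algebra_simps)

text \<open>A report equal to the true type changes nothing, so only the deviation to the other
  value counts. Overwriting the true type by \<open>t\<close> lets one \<theta> carry the
  constraints for both true types of \<open>i\<close>, as the influences at \<theta>
  require.\<close>

lemma bribeproof_two_values_iff:
  fixes M :: "'n::finite mechanism"
  shows "bribeproof (two_values L H) M \<longleftrightarrow>
    (\<forall>\<theta>\<in>profiles (two_values L H). \<forall>i j. \<forall>(t, x)\<in>{(L, H), (H, L)}.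
      (i \<noteq> j \<longrightarrow>
        utility M i t (replace i t \<theta>) + utility M j (\<theta> $ j) (replace i t \<theta>)
          \<ge> utility M i t (replace i x \<theta>) + utility M j (\<theta> $ j) (replace i x \<theta>)) \<and>
      (i = j \<longrightarrow> utility M i t (replace i t \<theta>) \<ge> utility M i t (replace i x \<theta>)))"
    (is "?B \<longleftrightarrow> ?R")
proof
  assume B: ?B
  show ?R
  proof (intro ballI allI)
    fix \<theta> :: "real ^ 'n" and i j :: 'n and p
    assume \<theta>: "\<theta> \<in> profiles (two_values L H)" and p: "p \<in> {(L, H), (H, L)}"
    obtain t x where tx: "p = (t, x)" "t \<in> two_values L H i" "x \<in> two_values L H i"
      using p by (auto simp: two_values_def)
    have "replace i t \<theta> \<in> profiles (two_values L H)"
      by (rule replace_in_profiles[OF \<theta> tx(2)])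
    from B[unfolded bribeproof_def, rule_format, OF this tx(3), of j] tx(1)
    show "case p of (t, x) \<Rightarrow>
      (i \<noteq> j \<longrightarrow>
        utility M i t (replace i t \<theta>) + utility M j (\<theta> $ j) (replace i t \<theta>)
          \<ge> utility M i t (replace i x \<theta>) + utility M j (\<theta> $ j) (replace i x \<theta>)) \<and>
      (i = j \<longrightarrow> utility M i t (replace i t \<theta>) \<ge> utility M i t (replace i x \<theta>))"
      by (auto simp: replace_nth)
  qed
next
  assume R: ?R
  show ?B
    unfolding bribeproof_def
  proof (intro ballI allI)
    fix \<theta> :: "real ^ 'n" and i j :: 'n and x
    assume \<theta>: "\<theta> \<in> profiles (two_values L H)" and x: "x \<in> two_values L H i"
    show "(i \<noteq> j \<longrightarrow>
        utility M i (\<theta> $ i) \<theta> + utility M j (\<theta> $ j) \<theta>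
          \<ge> utility M i (\<theta> $ i) (replace i x \<theta>) + utility M j (\<theta> $ j) (replace i x \<theta>)) \<and>
      (i = j \<longrightarrow> utility M i (\<theta> $ i) \<theta> \<ge> utility M i (\<theta> $ i) (replace i x \<theta>))"
    proof (cases "x = \<theta> $ i")
      case False
      then have "(\<theta> $ i, x) \<in> {(L, H), (H, L)}"
        using two_values_cases[OF \<theta>, of i] x by (auto simp: two_values_def)
      from R[THEN bspec, OF \<theta>, THEN spec[of _ i], THEN spec[of _ j], THEN bspec, OF this] show ?thesis
        by simp
    qed simp
  qed
qed

theorem corollary6:
  fixes L H :: real
    and F :: "(real ^ 'n::finite) set"
    and A :: "real ^ 'n \<Rightarrow> real ^ 'n"
    and f :: "real ^ 'n"
  assumes "CARD('n) \<ge> 2"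
    and "L < H"
    and "F \<subseteq> nonneg_orthant"
    and "A \<in> profiles (two_values L H) \<rightarrow> F"
  shows "bribeproof (two_values L H) (half_linear_mechanism L H f A) \<longleftrightarrow> bounded_influence L H A"
proof -
  let ?M = "half_linear_mechanism L H f A"
  define d where "d = (H - L) / 2"
  have d: "d > 0"
    using \<open>L < H\<close> by (simp add: d_def)
  have uL: "utility ?M k L \<eta> = A \<eta> $ k * d + f $ k"
    and uH: "utility ?M k H \<eta> = f $ k - A \<eta> $ k * d" for k \<eta>
    by (simp_all add: utility_half_linear_mechanism d_def field_simps)
  have key: "(\<forall>(t, x)\<in>{(L, H), (H, L)}.
      (i \<noteq> j \<longrightarrow>
        utility ?M i t (replace i t \<theta>) + utility ?M j (\<theta> $ j) (replace i t \<theta>)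
          \<ge> utility ?M i t (replace i x \<theta>) + utility ?M j (\<theta> $ j) (replace i x \<theta>)) \<and>
      (i = j \<longrightarrow> utility ?M i t (replace i t \<theta>) \<ge> utility ?M i t (replace i x \<theta>)))
    \<longleftrightarrow> influence L H A i i \<theta> \<ge> \<bar>influence L H A i j \<theta>\<bar>"
    if \<theta>: "\<theta> \<in> profiles (two_values L H)" for \<theta> i j
  proof -
    define a b where "a = A (replace i L \<theta>)" and "b = A (replace i H \<theta>)"
    have scale: "u * d \<le> v * d \<longleftrightarrow> u \<le> v" for u v
      using d by simp
    \<comment> \<open>After cancelling \<open>d\<close>, these say that the influences of
      \<open>i\<close> on her own work and on that of \<open>j\<close> have nonnegative sum and
      nonnegative difference.\<close>
    note facts = scale[of "b $ i + b $ j" "a $ i + a $ j"] scale[of "b $ i + a $ j" "a $ i + b $ j"]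
    show ?thesis
    proof (cases "i = j")
      case True
      \<comment> \<open>Both true types yield \<open>influence L H A i i \<theta> \<ge> 0\<close>,
        which is what a bound by its own absolute value means.\<close>
      then show ?thesis
        using d by (auto simp: uL uH influence_def)
    next
      case False
      \<comment> \<open>The type of \<open>j\<close> only decides which true type of
        \<open>i\<close> yields the sum and which the difference.\<close>
      from two_values_cases[OF \<theta>, of j] show ?thesis
      proof
        assume j: "\<theta> $ j = L"
        show ?thesis
          using False facts
          by (simp add: j uL uH influence_def distrib_right flip: a_def b_def) argo
      next
        assume j: "\<theta> $ j = H"
        show ?thesis
          using False facts
          by (simp add: j uL uH influence_def distrib_right flip: a_def b_def) argo
      qed
    qed
  qed
  show ?thesis
    unfolding bribeproof_two_values_iff bounded_influence_def using key by simp
qed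

end
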